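(* Let $f$ be a real symmetric function on pairs of positive integers. For $n\ge3$ let $M_f(n,S)$ be the maximum of $TI_f$ over all sequences of compressed actions with $n$ squares whose last action has second letter $S$, and $M_f(n,C)$ the maximum of $TI_f$ over all sequences of compressed actions with $n$ squares whose last action has second letter in $\{C,T\}$. Then for every $n\ge6$, $$M_f(n,S)=\max\{M_f(n-1,S)+g_f(SS),\ M_f(n-1,C)+g_f(CS)\},$$ $$M_f(n,C)=\max\{M_f(n-1,S)+g_f(SC),\ M_f(n-1,C)+g_f(CC),\ M_f(n-3,S)+g_f(ST),\ M_f(n-3,C)+g_f(CT)\}.$$
   Context: Local contributions: $g_f(SS)=3f(3,3)$; $g_f(SC)=3f(3,4)+f(2,4)+f(2,3)-2f(3,3)$; $g_f(CS)=f(3,4)-f(2,4)+f(2,3)+2f(3,3)$; $g_f(CC)=f(4,4)+2f(2,4)$; $g_f(TT)=f(2,3)+f(2,4)+f(3,4)+f(4,4)-f(3,3)$; $g_f(ST)=g_f(SC)+g_f(CS)+g_f(TT)$; $g_f(CT)=g_f(CC)+g_f(CS)+g_f(TT)$. A sequence of compressed actions is $(a_1,\dots,a_N)$ with $a_i\in\{SS,SC,CS,CC,ST,CT\}$, first letter $F_i\in\{S,C\}$ and second letter $S_i\in\{S,C,T\}$, subject to: $a_1\in\{SS,SC,ST\}$; if $S_i=S$ then $F_{i+1}=S$; if $S_i\in\{C,T\}$ then $F_{i+1}=C$. Its number of squares is $n=2+\#\{i:a_i\in\{SS,SC,CS,CC\}\}+3\#\{i:a_i\in\{ST,CT\}\}$,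 and its value is $TI_f((a_1,\dots,a_N))=c(a_1)+\sum_{i=2}^N g_f(a_i)$ with $c(SS)=2f(2,2)+4f(2,3)+4f(3,3)$, $c(SC)=2f(2,2)+4f(2,3)+2f(3,4)+2f(2,4)$, $c(ST)=c(SC)+g_f(CS)+g_f(TT)$. *)

theory Defs
  imports Complex_Main
begin

datatype letter = L_S | L_C | L_T

datatype action = SS | SC | CS | CC | ST | CT

fun first_letter :: "action \<Rightarrow> letter" where
  "first_letter SS = L_S"
| "first_letter SC = L_S"
| "first_letter ST = L_S"
| "first_letter CS = L_C"
| "first_letter CC = L_C"
| "first_letter CT = L_C"

fun second_letter :: "action \<Rightarrow> letter" where
  "second_letter SS = L_S"
| "second_letter CS = L_S"
| "second_letter SC = L_C"
| "second_letter CC = L_C"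
| "second_letter ST = L_T"
| "second_letter CT = L_T"

text \<open>\<open>TT\<close> is not itself a compressed action: it only enters through the contributions of
  \<open>ST\<close> and \<open>CT\<close>, hence the separate definition.\<close>

definition g_TT :: "(nat \<Rightarrow> nat \<Rightarrow> real) \<Rightarrow> real" where
  "g_TT f = f 2 3 + f 2 4 + f 3 4 + f 4 4 - f 3 3"

function g :: "(nat \<Rightarrow> nat \<Rightarrow> real) \<Rightarrow> action \<Rightarrow> real" where
  "g f SS = 3 * f 3 3"
| "g f SC = 3 * f 3 4 + f 2 4 + f 2 3 - 2 * f 3 3"
| "g f CS = f 3 4 - f 2 4 + f 2 3 + 2 * f 3 3"
| "g f CC = f 4 4 + 2 * f 2 4"
| "g f ST = g f SC + g f CS + g_TT f"
| "g f CT = g f CC + g f CS + g_TT f"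
  by pat_completeness auto
termination by (relation "measure (\<lambda>(f, a). if a \<in> {ST, CT} then 1 else 0)") auto

text \<open>The initial contribution is only meaningful for the admissible first actions
  \<open>SS\<close>, \<open>SC\<close>, \<open>ST\<close>; no sequence satisfying \<open>compressed_seq\<close> below uses the other values.\<close>

function c :: "(nat \<Rightarrow> nat \<Rightarrow> real) \<Rightarrow> action \<Rightarrow> real" where
  "c f SS = 2 * f 2 2 + 4 * f 2 3 + 4 * f 3 3"
| "c f SC = 2 * f 2 2 + 4 * f 2 3 + 2 * f 3 4 + 2 * f 2 4"
| "c f ST = c f SC + g f CS + g_TT f"
| "c f CS = undefined"
| "c f CC = undefined"
| "c f CT = undefined"
  by pat_completeness auto
termination by (relation "measure (\<lambda>(f, a). if a = ST then 1 else 0)") auto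

definition compressed_seq :: "action list \<Rightarrow> bool" where
  "compressed_seq as \<longleftrightarrow>
     as \<noteq> [] \<and> as ! 0 \<in> {SS, SC, ST} \<and>
     (\<forall>i. Suc i < length as \<longrightarrow>
        (second_letter (as ! i) = L_S \<longrightarrow> first_letter (as ! Suc i) = L_S) \<and>
        (second_letter (as ! i) \<in> {L_C, L_T} \<longrightarrow> first_letter (as ! Suc i) = L_C))"

definition num_squares :: "action list \<Rightarrow> nat" where
  "num_squares as =
     2 + card {i. i < length as \<and> as ! i \<in> {SS, SC, CS, CC}}
       + 3 * card {i. i < length as \<and> as ! i \<in> {ST, CT}}"

text \<open>Lists are indexed from 0, so the sum ranges over all actions but the first.\<close>

definition TI :: "(nat \<Rightarrow> nat \<Rightarrow> real) \<Rightarrow> action list \<Rightarrow> real" where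
  "TI f as = c f (as ! 0) + (\<Sum>i = 1..<length as. g f (as ! i))"

text \<open>\<open>M f n X\<close> is the maximum over the sequences with \<open>n\<close> squares whose last action has
  second letter in \<open>X\<close>. There are finitely many of them for each \<open>n\<close>, and for \<open>n \<ge> 3\<close>
  both sets used below are nonempty, so \<open>Max\<close> is the actual maximum.\<close>

definition M :: "(nat \<Rightarrow> nat \<Rightarrow> real) \<Rightarrow> nat \<Rightarrow> letter set \<Rightarrow> real" where
  "M f n X = Max {TI f as | as. compressed_seq as \<and> num_squares as = n \<and>
                                second_letter (last as) \<in> X}"

definition M_S :: "(nat \<Rightarrow> nat \<Rightarrow> real) \<Rightarrow> nat \<Rightarrow> real" where
  "M_S f n = M f n {L_S}"

definition M_C :: "(nat \<Rightarrow> nat \<Rightarrow> real) \<Rightarrow> nat \<Rightarrow> real" where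
  "M_C f n = M f n {L_C, L_T}"

end

theory Submission
  imports Defs
begin

text \<open>Delete the last action \<open>a\<close>. All constraints link neighbours, so what
  remains is any compressed sequence whose final second letter lies in
  \<open>predecessor_letters a\<close>, with \<open>weight a\<close> (1 or 3) fewer squares and a
  value smaller by \<open>g f a\<close>. Hence the sequences with \<open>n\<close> squares are a
  union, over the possible last actions, of extended shorter sequences (\<open>seqs_decomp\<close>),
  and the maximum over the union is the maximum of the translated maxima
  (\<open>M_recurrence\<close>). Since C and T constrain the next action alike, the only classes
  arising are \<open>{L_S}\<close> and \<open>{L_C, L_T}\<close>, so the recursion closes on
  \<open>M_S\<close> and \<open>M_C\<close>. The bound 6 ensures that the deleted action is not the
  first one, which contributes through \<open>c\<close>, and that the shorter sequences have at
  least 3 squares and so exist.\<close>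

fun weight :: "action \<Rightarrow> nat" where
  "weight ST = 3"
| "weight CT = 3"
| "weight _ = 1"

definition predecessor_letters :: "action \<Rightarrow> letter set" where
  "predecessor_letters a = (if first_letter a = L_S then {L_S} else {L_C, L_T})"

definition seqs :: "nat \<Rightarrow> letter set \<Rightarrow> action list set" where
  "seqs n X = {as. compressed_seq as \<and> num_squares as = n \<and> second_letter (last as) \<in> X}"

lemma M_eq_Max_image: "M f n X = Max (TI f ` seqs n X)"
  unfolding M_def seqs_def by (rule arg_cong[where f = Max]) auto

lemma Max_UN:
  fixes B :: "'a \<Rightarrow> 'b :: linorder set"
  assumes "finite A" "A \<noteq> {}" "\<And>a. a \<in> A \<Longrightarrow> finite (B a)" "\<And>a. a \<in> A \<Longrightarrow> B a \<noteq> {}"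
  shows "Max (\<Union>a\<in>A. B a) = Max ((\<lambda>a. Max (B a)) ` A)"
proof (rule Max_eqI)
  show "finite (\<Union>a\<in>A. B a)"
    using assms(1,3) by blast
  have "Max ((\<lambda>a. Max (B a)) ` A) \<in> (\<lambda>a. Max (B a)) ` A"
    using assms(1,2) by (intro Max_in) auto
  then show "Max ((\<lambda>a. Max (B a)) ` A) \<in> (\<Union>a\<in>A. B a)"
    using assms(3,4) Max_in by fastforce
next
  fix y assume "y \<in> (\<Union>a\<in>A. B a)"
  then obtain a where a: "a \<in> A" "y \<in> B a" by blast
  then have "y \<le> Max (B a)"
    using assms(3) by simp
  also have "\<dots> \<le> Max ((\<lambda>a. Max (B a)) ` A)"
    using assms(1) a(1) by simp
  finally show "y \<le> Max ((\<lambda>a. Max (B a)) ` A)" .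
qed

lemma UNIV_action: "UNIV = {SS, SC, CS, CC, ST, CT}"
  using action.exhaust by blast

text \<open>Replaces the index counts by an additive form, from which the effect of appending an
  action is immediate.\<close>

lemma num_squares_eq_sum_list: "num_squares as = 2 + sum_list (map weight as)"
proof -
  have "num_squares as = 2 + length (filter (\<lambda>a. a \<in> {SS, SC, CS, CC}) as)
      + 3 * length (filter (\<lambda>a. a \<in> {ST, CT}) as)"
    by (simp only: num_squares_def length_filter_conv_card)
  also have "\<dots> = 2 + sum_list (map weight as)"
  proof (induction as)
    case (Cons a as)
    then show ?case by (cases a) auto
  qed simp
  finally show ?thesis .
qed

lemma num_squares_snoc: "num_squares (as @ [a]) = num_squares as + weight a"
  by (simp add: num_squares_eq_sum_list)

lemma length_le_num_squares: "length as \<le> num_squares as"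
proof -
  have "length as \<le> sum_list (map weight as)"
  proof (induction as)
    case (Cons a as)
    then show ?case by (cases a) auto
  qed simp
  then show ?thesis by (simp add: num_squares_eq_sum_list)
qed

text \<open>Nonemptiness matters: a first action would contribute through \<open>c\<close> instead
  of \<open>g\<close>.\<close>

lemma TI_snoc: "as \<noteq> [] \<Longrightarrow> TI f (as @ [a]) = TI f as + g f a"
  by (simp add: TI_def nth_append sum.atLeastLessThan_Suc Suc_le_eq cong: sum.cong_simp)

lemma compressed_seq_snoc:
  assumes "as \<noteq> []"
  shows "compressed_seq (as @ [a]) \<longleftrightarrow>
    compressed_seq as \<and> second_letter (last as) \<in> predecessor_letters a"
proof -
  let ?link = "\<lambda>x y. (second_letter x = L_S \<longrightarrow> first_letter y = L_S) \<and>
    (second_letter x \<in> {L_C, L_T} \<longrightarrow> first_letter y = L_C)"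
  have nth0: "(as @ [a]) ! 0 = as ! 0"
    using assms by (simp add: nth_append)
  have "(\<forall>i. Suc i < length (as @ [a]) \<longrightarrow> ?link ((as @ [a]) ! i) ((as @ [a]) ! Suc i)) \<longleftrightarrow>
      (\<forall>i. Suc i < length as \<longrightarrow> ?link (as ! i) (as ! Suc i)) \<and> ?link (last as) a"
    (is "?L \<longleftrightarrow> ?R")
  proof
    assume L: ?L
    show ?R
    proof (intro conjI[of "\<forall>i. _ i"] allI impI)
      fix i assume "Suc i < length as"
      then show "?link (as ! i) (as ! Suc i)"
        using L[rule_format, of i] by (simp add: nth_append)
    next
      \<comment> \<open>At index \<open>length as - 1\<close> the successor position is that of the
        appended action.\<close>
      show "?link (last as) a"
        using L[rule_format, of "length as - 1"] assms by (simp add: nth_append last_conv_nth)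
    qed
  next
    assume R: ?R
    show ?L
    proof (intro allI impI)
      fix i assume "Suc i < length (as @ [a])"
      then consider "Suc i < length as" | "i = length as - 1" by fastforce
      then show "?link ((as @ [a]) ! i) ((as @ [a]) ! Suc i)"
      proof cases
        case 1
        then show ?thesis using R by (simp add: nth_append)
      next
        case 2
        then show ?thesis using R assms by (simp add: nth_append last_conv_nth)
      qed
    qed
  qed
  moreover have "?link (last as) a \<longleftrightarrow> second_letter (last as) \<in> predecessor_letters a"
    by (cases a; cases "last as") (auto simp: predecessor_letters_def)
  ultimately show ?thesis
    unfolding compressed_seq_def nth0 using assms by blast
qed

text \<open>Each action adds at least one square, so \<open>n\<close> bounds the length, and the
  alphabet is finite.\<close>

lemma finite_seqs: "finite (seqs n X)"
proof (rule finite_subset)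
  show "seqs n X \<subseteq> {as. set as \<subseteq> UNIV \<and> length as \<le> n}"
    using length_le_num_squares by (auto simp: seqs_def)
  show "finite {as :: action list. set as \<subseteq> UNIV \<and> length as \<le> n}"
    by (rule finite_lists_length_le) (simp add: UNIV_action)
qed

lemma seqs_nonempty_list: "as \<in> seqs n X \<Longrightarrow> as \<noteq> []"
  by (auto simp: seqs_def compressed_seq_def)

lemma snoc_in_seqs:
  assumes "as \<in> seqs n (predecessor_letters a)" "second_letter a \<in> X"
  shows "as @ [a] \<in> seqs (n + weight a) X"
  using assms seqs_nonempty_list[OF assms(1)]
  by (simp add: seqs_def compressed_seq_snoc num_squares_snoc)

lemma singleton_in_seqs: "[SS] \<in> seqs 3 {L_S}" "[SC] \<in> seqs 3 {L_C, L_T}"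
  by (simp_all add: seqs_def compressed_seq_def num_squares_eq_sum_list)

lemma seqs_nonempty:
  assumes "n \<ge> 3"
  shows "seqs n {L_S} \<noteq> {}" "seqs n {L_C, L_T} \<noteq> {}"
proof -
  have "seqs n {L_S} \<noteq> {} \<and> seqs n {L_C, L_T} \<noteq> {}"
    using assms
  proof (induction n rule: dec_induct)
    case base
    then show ?case using singleton_in_seqs by blast
  next
    case (step n)
    \<comment> \<open>Both \<open>SS\<close> and \<open>SC\<close> have first letter S and weight 1,
      so one sequence ending in S yields members of both classes.\<close>
    then obtain as where "as \<in> seqs n {L_S}" by blast
    then show ?case
      using snoc_in_seqs[of as n SS "{L_S}"] snoc_in_seqs[of as n SC "{L_C, L_T}"]
      by (auto simp: predecessor_letters_def)
  qed
  then show "seqs n {L_S} \<noteq> {}" "seqs n {L_C, L_T} \<noteq> {}" by auto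
qed

text \<open>From \<open>n = 6\<close> on no sequence is a single action, since those have 3 or 5 squares.\<close>

lemma seqs_decomp:
  assumes "n \<ge> 6"
  shows "seqs n X = (\<Union>a\<in>{a. second_letter a \<in> X}.
    (\<lambda>as. as @ [a]) ` seqs (n - weight a) (predecessor_letters a))"
proof (intro equalityI subsetI)
  fix as assume as: "as \<in> seqs n X"
  then obtain bs a where snoc: "as = bs @ [a]"
    by (metis rev_exhaust seqs_nonempty_list)
  have num: "num_squares bs + weight a = n" and a: "second_letter a \<in> X"
    using as by (auto simp: seqs_def snoc num_squares_snoc)
  have "bs \<noteq> []"
    using num assms by (cases a) (auto simp: num_squares_eq_sum_list)
  then have "bs \<in> seqs (n - weight a) (predecessor_letters a)"
    using as num by (auto simp: seqs_def snoc compressed_seq_snoc)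
  then show "as \<in> (\<Union>a\<in>{a. second_letter a \<in> X}.
    (\<lambda>as. as @ [a]) ` seqs (n - weight a) (predecessor_letters a))"
    using a snoc by blast
next
  fix as assume "as \<in> (\<Union>a\<in>{a. second_letter a \<in> X}.
    (\<lambda>as. as @ [a]) ` seqs (n - weight a) (predecessor_letters a))"
  then obtain a bs where "second_letter a \<in> X" "as = bs @ [a]"
    "bs \<in> seqs (n - weight a) (predecessor_letters a)" by blast
  \<comment> \<open>Weights are at most 3, so the natural-number subtraction does not
    truncate.\<close>
  moreover have "n - weight a + weight a = n"
    using assms by (cases a) auto
  ultimately show "as \<in> seqs n X"
    using snoc_in_seqs by metis
qed

text \<open>The action \<open>a\<^sub>0\<close> only witnesses that some last action is allowed, so
  that the outer \<open>Max\<close> ranges over a nonempty set.\<close>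

lemma M_recurrence:
  assumes "n \<ge> 6" and "second_letter a\<^sub>0 \<in> X"
  shows "M f n X =
    Max ((\<lambda>a. M f (n - weight a) (predecessor_letters a) + g f a) ` {a. second_letter a \<in> X})"
proof -
  let ?A = "{a. second_letter a \<in> X}"
  let ?V = "\<lambda>a. TI f ` seqs (n - weight a) (predecessor_letters a)"
  have finA: "finite ?A"
    by (rule finite_subset[OF subset_UNIV]) (simp add: UNIV_action)
  have neA: "?A \<noteq> {}"
    using assms(2) by blast
  \<comment> \<open>Here \<open>n - weight a\<close> is at least 3, and
    \<open>predecessor_letters a\<close> is one of the two classes known to be inhabited.\<close>
  have neV: "?V a \<noteq> {}" for a
    using assms(1) seqs_nonempty[of "n - weight a"]
    by (cases a) (auto simp: predecessor_letters_def)
  have "TI f ` seqs n X = (\<Union>a\<in>?A. (\<lambda>x. x + g f a) ` ?V a)"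
    unfolding seqs_decomp[OF assms(1)] image_UN image_image
    by (intro SUP_cong image_cong refl TI_snoc seqs_nonempty_list)
  then have "M f n X = Max (\<Union>a\<in>?A. (\<lambda>x. x + g f a) ` ?V a)"
    by (simp add: M_eq_Max_image)
  also have "\<dots> = Max ((\<lambda>a. Max ((\<lambda>x. x + g f a) ` ?V a)) ` ?A)"
    by (subst Max_UN) (use finA neA neV finite_seqs in \<open>auto\<close>)
  \<comment> \<open>Adding the constant \<open>g f a\<close> commutes with \<open>Max\<close> on a
    finite nonempty set.\<close>
  also have "\<dots> = Max ((\<lambda>a. Max (?V a) + g f a) ` ?A)"
  proof (intro arg_cong[where f = Max] image_cong refl)
    fix a
    show "Max ((\<lambda>x. x + g f a) ` ?V a) = Max (?V a) + g f a"
      using neV[of a] finite_seqs by (subst Max_add_commute) (auto)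
  qed
  finally show ?thesis
    by (simp only: M_eq_Max_image)
qed

theorem theorem5p1:
  fixes f :: "nat \<Rightarrow> nat \<Rightarrow> real" and n :: nat
  assumes symmetric: "\<And>i j. 1 \<le> i \<Longrightarrow> 1 \<le> j \<Longrightarrow> f i j = f j i"
    and "n \<ge> 6"
  shows "M_S f n = Max {M_S f (n - 1) + g f SS, M_C f (n - 1) + g f CS} \<and>
    M_C f n = Max {M_S f (n - 1) + g f SC, M_C f (n - 1) + g f CC,
                   M_S f (n - 3) + g f ST, M_C f (n - 3) + g f CT}"
proof -
  \<comment> \<open>Listing the last actions of each class turns the general recurrence into two and
    four terms, with \<open>SS\<close> and \<open>SC\<close> as nonemptiness witnesses.\<close>
  have S: "{a. second_letter a \<in> {L_S}} = {SS, CS}"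
    by (auto elim: second_letter.elims)
  have C: "{a. second_letter a \<in> {L_C, L_T}} = {SC, CC, ST, CT}"
    by (auto elim: second_letter.elims)
  show ?thesis
    unfolding M_S_def M_C_def
    using M_recurrence[OF \<open>n \<ge> 6\<close>, of SS "{L_S}" f] M_recurrence[OF \<open>n \<ge> 6\<close>, of SC "{L_C, L_T}" f]
    unfolding S C by (simp add: predecessor_letters_def del: g.simps)
qed

end
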